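(* In generalised linear bandits, EVILL (with perturbation scale $a>0$) reduces to a variant of GLM-PHE where the perturbation vector used by PHE in round $t$ is $$Z_t\sim\mathcal N\Big(0,\;a^2\operatorname{diag}\big(I(X_1^\top\hat\theta_{t-1}),\dots,I(X_{t-1}^\top\hat\theta_{t-1})\big)\Big).$$
   Context: Generalised linear bandit. $Q$ is a probability distribution on $\mathbb{R}$ with cumulant-generating function $\psi(u)=\log\int e^{uy}Q(dy)$; $\mathcal U_Q=\{u:\psi(u)<\infty\}$ has non-empty interior $\mathcal U_Q^\circ$. The reward of an arm $x\in\mathcal X\subset\mathbb{R}^d$ under the unknown parameter $\theta_\star$ has distribution $Q_{x^\top\theta_\star}$, where $Q_u(dy)=\exp(yu-\psi(u))Q(dy)$ for $u\in\mathcal U$, and $\mathcal U\subset\mathcal U_Q^\circ$ is an interval with non-empty interior. $X_i$ and $Y_i$ are the arm played and the reward observed in round $i$, and $\mathcal D_{t-1}=((X_i,Y_i))_{i=1}^{t-1}$. $\mu(u)$ is the mean of $Q_u$. The Fisher information map is $I(u)=\int\frac{\partial^2}{\partial u^2}\log\frac1{p(y;u)}\,Q_u(dy)$ with $p(y;u)=\exp(yu-\psi(u))$. Losses. Let $\ell(y;u)=-yu+\psi(u)$ if $y\in\operatorname{supp}(Q)$ and $+\infty$ otherwise, and let its linear extension be $\tilde\ell(y;u)=-yu+\psi(u)$ for all $y\in\mathbb{R}$. For $\lambda>0$ and $\mathcal D=((x_i,y_i))_{i=1}^s$ set $\mathcal L(\theta;\mathcal D)=\frac\lambda2\|\theta\|^2+\sum_{i=1}^s\ell(y_i;x_i^\top\theta)$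 and $\widetilde{\mathcal L}(\theta;\mathcal D)=\frac\lambda2\|\theta\|^2+\sum_{i=1}^s\tilde\ell(y_i;x_i^\top\theta)$. For $z\in\mathbb{R}^s$ let $\mathcal D^z=((x_i,y_i+z_i))_{i=1}^s$. GLM-PHE (perturbed history exploration with additive reward perturbations for generalised linear models). In round $t$ it computes $\theta_t\in\arg\min_\theta\widetilde{\mathcal L}(\theta;\mathcal D_{t-1}^{Z_t})$, where the perturbation vector $Z_t\sim\mathcal N(0,aI_{t-1})$ is chosen independently of the past, and plays the arm that is optimal under $\theta_t$. A variant of GLM-PHE is obtained by replacing the distribution of the perturbation vector $Z_t$ by another one, possibly depending on the past data. EVILL (exploration via linear loss perturbations; feasible parameter set $\Theta'\subset\mathbb{R}^d$). In round $t$ it computes $\hat\theta_{t-1}\in\arg\min_{\theta\in\Theta'}\mathcal L(\theta;\mathcal D_{t-1})$ (this is the $\hat\theta_{t-1}$ in the claim); samples $\xi_t\sim\mathcal N(0,I_d)$ and $\xi'_t\sim\mathcal N(0,I_{t-1})$; sets $W_t=a\lambda^{1/2}\xi_t+a\sum_{i=1}^{t-1}I(X_i^\top\hat\theta_{t-1})^{1/2}\xi'_{t,i}X_i$; computes $\theta_t\in\arg\min_{\theta\in\Theta'}\mathcal L(\theta;\mathcal D_{t-1})+W_t^\top\theta$; and plays $X_t\in\arg\max_{x\in\mathcal X}\mu(x^\top\theta_t)$. Minimisers and maximisers are assumed to exist.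
   Formalization: The GLM-PHE variant here also minimises over Θ' and adds to its loss an independent linear term aλ^{1/2}ξ_t^Tθ; without this the claim fails (in round 1, with no data, PHE gives θ_1=0 but EVILL with Θ'=R^d gives θ_1=-aλ^{-1/2}ξ_1). *)

theory Defs
  imports "HOL-Probability.Probability"
begin

section \<open>Exponential family\<close>

definition cgf :: "real measure \<Rightarrow> real \<Rightarrow> ereal" where
  "cgf Q u = (let m = (\<integral>\<^sup>+y. ennreal (exp (u * y)) \<partial>Q)
              in if m = \<infinity> then \<infinity> else ereal (ln (enn2real m)))"

definition cgf_dom :: "real measure \<Rightarrow> real set" where
  "cgf_dom Q = {u. cgf Q u < \<infinity>}"

definition supp :: "real measure \<Rightarrow> real set" where
  "supp Q = {y. \<forall>S. open S \<longrightarrow> y \<in> S \<longrightarrow> emeasure Q S > 0}"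

definition ef_density :: "real measure \<Rightarrow> real \<Rightarrow> real \<Rightarrow> real" where
  "ef_density Q y u = exp (y * u - real_of_ereal (cgf Q u))"

definition ef :: "real measure \<Rightarrow> real \<Rightarrow> real measure" where
  "ef Q u = density Q (\<lambda>y. ennreal (ef_density Q y u))"

definition ef_mean :: "real measure \<Rightarrow> real \<Rightarrow> real" where
  "ef_mean Q u = (\<integral>y. y \<partial>ef Q u)"

definition fisher :: "real measure \<Rightarrow> real \<Rightarrow> real" where
  "fisher Q u = (\<integral>y. (deriv ^^ 2) (\<lambda>v. ln (1 / ef_density Q y v)) u \<partial>ef Q u)"


section \<open>Losses\<close>

type_synonym 'd dataset = "((real ^ 'd) \<times> real) list"

definition nll :: "real measure \<Rightarrow> real \<Rightarrow> real \<Rightarrow> ereal" where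
  "nll Q y u = (if y \<in> supp Q then ereal (- y * u) + cgf Q u else \<infinity>)"

definition nll_ext :: "real measure \<Rightarrow> real \<Rightarrow> real \<Rightarrow> ereal" where
  "nll_ext Q y u = ereal (- y * u) + cgf Q u"

definition loss :: "real measure \<Rightarrow> real \<Rightarrow> 'd::finite dataset \<Rightarrow> real ^ 'd \<Rightarrow> ereal" where
  "loss Q lam D \<theta> = ereal (lam / 2 * (norm \<theta>)\<^sup>2) + (\<Sum>(x, y)\<leftarrow>D. nll Q y (x \<bullet> \<theta>))"

definition loss_ext :: "real measure \<Rightarrow> real \<Rightarrow> 'd::finite dataset \<Rightarrow> real ^ 'd \<Rightarrow> ereal" where
  "loss_ext Q lam D \<theta> = ereal (lam / 2 * (norm \<theta>)\<^sup>2) + (\<Sum>(x, y)\<leftarrow>D. nll_ext Q y (x \<bullet> \<theta>))"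

definition perturb :: "'d::finite dataset \<Rightarrow> (nat \<Rightarrow> real) \<Rightarrow> 'd dataset" where
  "perturb D z = map (\<lambda>i. (fst (D ! i), snd (D ! i) + z i)) [0..<length D]"


section \<open>Centred normal laws\<close>

text \<open>The parameter is the variance; it may be zero, in which case the law is the point mass at 0
  (this happens for the Fisher information when the base distribution is a point mass).\<close>

definition normal_law :: "real \<Rightarrow> real measure" where
  "normal_law v = distr (density lborel (\<lambda>x. ennreal (std_normal_density x))) borel
     (\<lambda>x. sqrt v * x)"

text \<open>The law on \<open>\<real>\<^sup>n\<close> with covariance matrix \<open>diag(v 0, \<dots>, v (n - 1))\<close>.  The dimension varies with
  the round, so vectors are functions on the index set \<open>{..<n}\<close>.\<close>

definition normal_diag :: "nat \<Rightarrow> (nat \<Rightarrow> real) \<Rightarrow> (nat \<Rightarrow> real) measure" where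
  "normal_diag n v = (\<Pi>\<^sub>M i\<in>{..<n}. normal_law (v i))"

text \<open>The law on \<open>\<real>\<^sup>d\<close> with covariance matrix \<open>v\<close> times the identity.\<close>

definition normal_iso :: "real \<Rightarrow> (real ^ 'd::finite) measure" where
  "normal_iso v = distr (\<Pi>\<^sub>M j\<in>UNIV. normal_law v) borel (\<lambda>f. \<chi> j. f j)"


section \<open>Conditional laws\<close>

text \<open>\<open>\<kappa>\<close> is a version of the conditional law of the \<open>S\<close>-valued random variable \<open>V\<close> given the
  sub-\<open>\<sigma>\<close>-algebra \<open>F\<close>.  If \<open>\<kappa>\<close> does not depend on the outcome, this says that \<open>V\<close> has law \<open>\<kappa>\<close> and is
  independent of \<open>F\<close>.\<close>

definition cond_law ::
    "'w measure \<Rightarrow> 'w measure \<Rightarrow> 'b measure \<Rightarrow> ('w \<Rightarrow> 'b) \<Rightarrow> ('w \<Rightarrow> 'b measure) \<Rightarrow> bool" where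
  "cond_law M F S V \<kappa> \<longleftrightarrow> V \<in> measurable M S \<and>
     (\<forall>B\<in>sets S. AE \<omega> in M.
        real_cond_exp M F (indicator (V -` B \<inter> space M)) \<omega> = measure (\<kappa> \<omega>) B)"


section \<open>Generalised linear bandits\<close>

locale glm_bandit =
  fixes Q :: "real measure" and U :: "real set"
    and arms :: "(real ^ 'd::finite) set" and \<theta>s :: "real ^ 'd"
  assumes prob_Q: "prob_space Q"
    and sets_Q: "sets Q = sets borel"
    and interior_cgf_dom: "interior (cgf_dom Q) \<noteq> {}"
    and U_subset: "U \<subseteq> interior (cgf_dom Q)"
    and U_interval: "is_interval U"
    and interior_U: "interior U \<noteq> {}"
    and natural_parameter: "\<And>x. x \<in> arms \<Longrightarrow> x \<bullet> \<theta>s \<in> U"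

text \<open>Rounds are numbered from 0, so that \<open>t\<close> observations are available at the start of round \<open>t\<close>.\<close>

definition history ::
    "(nat \<Rightarrow> 'w \<Rightarrow> real ^ 'd::finite) \<Rightarrow> (nat \<Rightarrow> 'w \<Rightarrow> real) \<Rightarrow> nat \<Rightarrow> 'w \<Rightarrow> 'd dataset" where
  "history X Y t \<omega> = map (\<lambda>i. (X i \<omega>, Y i \<omega>)) [0..<t]"

text \<open>\<open>F t\<close> is the information available at the start of round \<open>t\<close>, and \<open>G t\<close> the information
  available in round \<open>t\<close> after the arm has been chosen and before the reward is observed.\<close>

definition interaction ::
    "'w measure \<Rightarrow> real measure \<Rightarrow> (real ^ 'd::finite) set \<Rightarrow> real ^ 'd \<Rightarrow>
     (nat \<Rightarrow> 'w measure) \<Rightarrow> (nat \<Rightarrow> 'w measure) \<Rightarrow>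
     (nat \<Rightarrow> 'w \<Rightarrow> real ^ 'd) \<Rightarrow> (nat \<Rightarrow> 'w \<Rightarrow> real) \<Rightarrow> bool" where
  "interaction M Q arms \<theta>s F G X Y \<longleftrightarrow> prob_space M \<and>
     (\<forall>t. subalgebra M (F t) \<and> subalgebra M (G t) \<and>
          subalgebra (G t) (F t) \<and> subalgebra (F (Suc t)) (G t) \<and>
          X t \<in> borel_measurable (G t) \<and> (AE \<omega> in M. X t \<omega> \<in> arms) \<and>
          Y t \<in> borel_measurable (F (Suc t)) \<and>
          cond_law M (G t) borel (Y t) (\<lambda>\<omega>. ef Q (X t \<omega> \<bullet> \<theta>s)))"

text \<open>In each round the arm played is optimal for the parameter \<open>\<theta> t\<close>.\<close>

definition plays_optimal ::
    "'w measure \<Rightarrow> real measure \<Rightarrow> (real ^ 'd::finite) set \<Rightarrow>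
     (nat \<Rightarrow> 'w \<Rightarrow> real ^ 'd) \<Rightarrow> (nat \<Rightarrow> 'w \<Rightarrow> real ^ 'd) \<Rightarrow> bool" where
  "plays_optimal M Q arms \<theta> X \<longleftrightarrow>
     (\<forall>t. AE \<omega> in M. is_arg_max (\<lambda>x. ef_mean Q (x \<bullet> \<theta> t \<omega>)) (\<lambda>x. x \<in> arms) (X t \<omega>))"


section \<open>GLM-PHE\<close>

text \<open>A run of GLM-PHE whose reward perturbation vector \<open>Z t\<close> has, given the past, the law
  \<open>\<kappa> D\<close> determined by the data \<open>D\<close> collected so far.  Minimisation is over the feasible set \<open>\<Theta>\<close>,
  and the ridge penalty is perturbed by the linear term \<open>V t \<bullet> \<theta>\<close>, where \<open>V t\<close> has law \<open>\<rho>\<close> and is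
  independent of the past and, given the past, of \<open>Z t\<close>.

  The basic form of GLM-PHE, with unconstrained minimisation and no perturbation other than that of
  the rewards, is the case \<open>\<Theta> = UNIV\<close>, \<open>\<rho> = return borel 0\<close>, \<open>V = (\<lambda>t \<omega>. 0)\<close>; with reward
  perturbations of constant variance \<open>a\<close>, \<open>\<kappa> D = normal_diag (length D) (\<lambda>i. a)\<close>.\<close>

definition glm_phe_run ::
    "'w measure \<Rightarrow> real measure \<Rightarrow> (real ^ 'd::finite) set \<Rightarrow> real ^ 'd \<Rightarrow> real \<Rightarrow>
     (real ^ 'd) set \<Rightarrow> ('d dataset \<Rightarrow> (nat \<Rightarrow> real) measure) \<Rightarrow> (real ^ 'd) measure \<Rightarrow>
     (nat \<Rightarrow> 'w measure) \<Rightarrow> (nat \<Rightarrow> 'w measure) \<Rightarrow>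
     (nat \<Rightarrow> 'w \<Rightarrow> nat \<Rightarrow> real) \<Rightarrow> (nat \<Rightarrow> 'w \<Rightarrow> real ^ 'd) \<Rightarrow>
     (nat \<Rightarrow> 'w \<Rightarrow> real ^ 'd) \<Rightarrow> (nat \<Rightarrow> 'w \<Rightarrow> real ^ 'd) \<Rightarrow> (nat \<Rightarrow> 'w \<Rightarrow> real) \<Rightarrow> bool" where
  "glm_phe_run M Q arms \<theta>s lam \<Theta> \<kappa> \<rho> F G Z V \<theta> X Y \<longleftrightarrow>
     interaction M Q arms \<theta>s F G X Y \<and>
     (\<forall>t. V t \<in> borel_measurable (G t) \<and>
          Z t \<in> measurable (G t) (\<Pi>\<^sub>M i\<in>{..<t}. borel) \<and>
          cond_law M (F t) (borel \<Otimes>\<^sub>M (\<Pi>\<^sub>M i\<in>{..<t}. borel)) (\<lambda>\<omega>. (V t \<omega>, Z t \<omega>))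
            (\<lambda>\<omega>. \<rho> \<Otimes>\<^sub>M \<kappa> (history X Y t \<omega>)) \<and>
          \<theta> t \<in> borel_measurable (G t) \<and>
          (AE \<omega> in M. is_arg_min
             (\<lambda>\<eta>. loss_ext Q lam (perturb (history X Y t \<omega>) (Z t \<omega>)) \<eta> + ereal (V t \<omega> \<bullet> \<eta>))
             (\<lambda>\<eta>. \<eta> \<in> \<Theta>) (\<theta> t \<omega>))) \<and>
     plays_optimal M Q arms \<theta> X"


section \<open>EVILL\<close>

definition evill_perturbation ::
    "real measure \<Rightarrow> real \<Rightarrow> real \<Rightarrow> 'd::finite dataset \<Rightarrow> real ^ 'd \<Rightarrow>
     real ^ 'd \<Rightarrow> (nat \<Rightarrow> real) \<Rightarrow> real ^ 'd" where
  "evill_perturbation Q lam a D \<theta>hat \<xi> \<xi>' =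
     (a * sqrt lam) *\<^sub>R \<xi> +
     a *\<^sub>R (\<Sum>i<length D. (sqrt (fisher Q (fst (D ! i) \<bullet> \<theta>hat)) * \<xi>' i) *\<^sub>R fst (D ! i))"

text \<open>The map \<open>est\<close> computes the unperturbed minimiser from the data.\<close>

definition evill_run ::
    "'w measure \<Rightarrow> real measure \<Rightarrow> (real ^ 'd::finite) set \<Rightarrow> real ^ 'd \<Rightarrow> real \<Rightarrow> real \<Rightarrow>
     (real ^ 'd) set \<Rightarrow> ('d dataset \<Rightarrow> real ^ 'd) \<Rightarrow>
     (nat \<Rightarrow> 'w measure) \<Rightarrow> (nat \<Rightarrow> 'w measure) \<Rightarrow>
     (nat \<Rightarrow> 'w \<Rightarrow> real ^ 'd) \<Rightarrow> (nat \<Rightarrow> 'w \<Rightarrow> nat \<Rightarrow> real) \<Rightarrow>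
     (nat \<Rightarrow> 'w \<Rightarrow> real ^ 'd) \<Rightarrow> (nat \<Rightarrow> 'w \<Rightarrow> real ^ 'd) \<Rightarrow> (nat \<Rightarrow> 'w \<Rightarrow> real) \<Rightarrow> bool" where
  "evill_run M Q arms \<theta>s lam a \<Theta>' est F G \<xi> \<xi>' \<theta> X Y \<longleftrightarrow>
     interaction M Q arms \<theta>s F G X Y \<and>
     (\<forall>t. (\<lambda>\<omega>. est (history X Y t \<omega>)) \<in> borel_measurable (F t) \<and>
          (AE \<omega> in M. is_arg_min (loss Q lam (history X Y t \<omega>)) (\<lambda>\<eta>. \<eta> \<in> \<Theta>')
             (est (history X Y t \<omega>))) \<and>
          \<xi> t \<in> borel_measurable (G t) \<and>
          \<xi>' t \<in> measurable (G t) (\<Pi>\<^sub>M i\<in>{..<t}. borel) \<and>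
          cond_law M (F t) (borel \<Otimes>\<^sub>M (\<Pi>\<^sub>M i\<in>{..<t}. borel)) (\<lambda>\<omega>. (\<xi> t \<omega>, \<xi>' t \<omega>))
            (\<lambda>\<omega>. normal_iso 1 \<Otimes>\<^sub>M normal_diag t (\<lambda>i. 1)) \<and>
          \<theta> t \<in> borel_measurable (G t) \<and>
          (AE \<omega> in M. is_arg_min
             (\<lambda>\<eta>. loss Q lam (history X Y t \<omega>) \<eta> +
                  ereal (evill_perturbation Q lam a (history X Y t \<omega>) (est (history X Y t \<omega>))
                    (\<xi> t \<omega>) (\<xi>' t \<omega>) \<bullet> \<eta>))
             (\<lambda>\<eta>. \<eta> \<in> \<Theta>') (\<theta> t \<omega>))) \<and>
     plays_optimal M Q arms \<theta> X"

end

theory Submission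
  imports Defs
begin

text \<open>Shifting the \<open>i\<close>-th reward by \<open>z\<^sub>i\<close> changes the extended loss by the linear term
  \<open>- z\<^sub>i (X\<^sub>i \<bullet> \<eta>)\<close>, so the linear perturbation of EVILL is the shift by
  \<open>Z\<^sub>i = - a I(X\<^sub>i \<bullet> est)\<^bsup>1/2\<^esup> \<xi>'\<^sub>i\<close> together with the perturbation \<open>a \<lambda>\<^bsup>1/2\<^esup> \<xi>\<close> of the
  ridge penalty.  The two losses agree because rewards almost surely lie in the support of \<open>Q\<close>.
  For the conditional law of \<open>Z\<close>, the coefficients \<open>I(X\<^sub>i \<bullet> est)\<close> are known from the past and
  \<open>\<xi>'\<close> is independent of it, so they may be treated as constants.  This needs the Fisher
  information to be a Borel function on all of \<open>\<real>\<close>: it is a rational expression in moments of the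
  tilted measure in the interior of the domain of the cumulant-generating function, \<open>0\<close> outside
  its closure (where the function takes a junk value), and the frontier has at most two points.\<close>

section \<open>Conditioning on the past\<close>

text \<open>Integrating the constant conditional probability over a set of \<open>F\<close> makes
  that set independent of the event that \<open>V\<close> lies in \<open>B\<close>, and rectangles
  determine a product measure. The outcome itself serves as the \<open>F\<close>-measurable
  variable, so independence from all of \<open>F\<close> becomes a single product law.\<close>

lemma cond_law_indep_joint:
  assumes M: "prob_space M" and sub: "subalgebra M F"
    and V: "cond_law M F N V (\<lambda>_. P)" and P: "prob_space P" and sP: "sets P = sets N"
  shows "distr M (restr_to_subalg M F \<Otimes>\<^sub>M P) (\<lambda>\<omega>. (\<omega>, V \<omega>)) = restr_to_subalg M F \<Otimes>\<^sub>M P"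
proof -
  interpret M: prob_space M by fact
  interpret P: prob_space P by fact
  interpret R: prob_space "restr_to_subalg M F"
    by (rule prob_space_restr_to_subalg[OF sub M])
  interpret S: finite_measure_subalgebra M F
    by unfold_locales (rule sub)
  have id_meas: "(\<lambda>\<omega>. \<omega>) \<in> measurable M (restr_to_subalg M F)"
    using sub by (auto simp: measurable_def space_restr_to_subalg sets_restr_to_subalg
      subalgebra_def intro!: sets.sets_into_space sets.Int)
  have V_meas: "V \<in> measurable M P"
    using V measurable_cong_sets[OF refl sP] by (auto simp: cond_law_def)
  show ?thesis
  proof (rule pair_measure_eqI[symmetric])
    fix A B assume "A \<in> sets (restr_to_subalg M F)" and B: "B \<in> sets P"
    then have A: "A \<in> sets F" by (simp add: sets_restr_to_subalg[OF sub])
    have AM: "A \<in> sets M" using A sub by (auto simp: subalgebra_def)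
    have VB: "V -` B \<inter> space M \<in> sets M" using V_meas B by (rule measurable_sets)
    let ?f = "indicator (V -` B \<inter> space M) :: _ \<Rightarrow> real"
    have "measure M (A \<inter> (V -` B \<inter> space M)) = (\<integral>x\<in>A. ?f x \<partial>M)"
      using AM VB by (simp add: set_lebesgue_integral_def flip: indicator_inter_arith)
    also have "\<dots> = (\<integral>x\<in>A. real_cond_exp M F ?f x \<partial>M)"
      using VB A by (intro S.real_cond_exp_intA) (auto simp: integrable_indicator_iff M.emeasure_eq_measure)
    also have "\<dots> = (\<integral>x\<in>A. measure P B \<partial>M)"
    proof (rule set_lebesgue_integral_cong_AE)
      have "AE x in M. real_cond_exp M F ?f x = measure P B"
        using V B sP by (auto simp: cond_law_def)
      then show "AE x\<in>A in M. real_cond_exp M F ?f x = measure P B" by auto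
    qed (use AM in auto)
    also have "\<dots> = measure M A * measure P B" using AM by (simp add: set_lebesgue_integral_def)
    finally have eq: "measure M (A \<inter> (V -` B \<inter> space M)) = measure M A * measure P B" .
    have "(\<lambda>\<omega>. (\<omega>, V \<omega>)) -` (A \<times> B) \<inter> space M = A \<inter> (V -` B \<inter> space M)" by auto
    then have "emeasure (distr M (restr_to_subalg M F \<Otimes>\<^sub>M P) (\<lambda>\<omega>. (\<omega>, V \<omega>))) (A \<times> B) =
        emeasure M (A \<inter> (V -` B \<inter> space M))"
      using A B id_meas V_meas by (subst emeasure_distr) (auto simp: sets_restr_to_subalg[OF sub])
    also have "\<dots> = emeasure (restr_to_subalg M F) A * emeasure P B"
      by (simp add: M.emeasure_eq_measure P.emeasure_eq_measure eq ennreal_mult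
        emeasure_restr_to_subalg[OF sub A])
    finally show "emeasure (restr_to_subalg M F) A * emeasure P B =
      emeasure (distr M (restr_to_subalg M F \<Otimes>\<^sub>M P) (\<lambda>\<omega>. (\<omega>, V \<omega>))) (A \<times> B)" by simp
  qed (simp_all add: R.sigma_finite_measure_axioms P.sigma_finite_measure_axioms)
qed

text \<open>The freezing principle: under the product law of the past and \<open>V\<close>, Fubini
  lets the past be held fixed while only the fresh noise is integrated out.\<close>

lemma cond_law_freeze:
  assumes M: "prob_space M" and sub: "subalgebra M F"
    and V: "cond_law M F N V (\<lambda>_. P)" and P: "prob_space P" and sP: "sets P = sets N"
    and h: "h \<in> measurable (F \<Otimes>\<^sub>M N) S"
  shows "cond_law M F S (\<lambda>\<omega>. h (\<omega>, V \<omega>)) (\<lambda>\<omega>. distr P S (\<lambda>v. h (\<omega>, v)))"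
proof -
  interpret M: prob_space M by fact
  interpret P: prob_space P by fact
  interpret R: prob_space "restr_to_subalg M F"
    by (rule prob_space_restr_to_subalg[OF sub M])
  interpret S: finite_measure_subalgebra M F
    by unfold_locales (rule sub)
  interpret RP: pair_prob_space "restr_to_subalg M F" P ..
  let ?R = "restr_to_subalg M F"
  note sR = sets_restr_to_subalg[OF sub]
  have id_meas: "(\<lambda>\<omega>. \<omega>) \<in> measurable M F"
    using sub by (auto simp: measurable_def subalgebra_def intro!: sets.sets_into_space sets.Int)
  have V_N: "V \<in> measurable M N" using V by (simp add: cond_law_def)
  have pair_meas: "(\<lambda>\<omega>. (\<omega>, V \<omega>)) \<in> measurable M (?R \<Otimes>\<^sub>M P)"
    using id_meas V_N by (simp add: measurable_cong_sets[OF refl sets_pair_measure_cong[OF sR sP]])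
  have h': "h \<in> measurable (?R \<Otimes>\<^sub>M P) S"
    using h by (simp add: measurable_cong_sets[OF sets_pair_measure_cong[OF sR sP] refl])
  have hV: "(\<lambda>\<omega>. h (\<omega>, V \<omega>)) \<in> measurable M S"
    using measurable_compose[OF pair_meas h'] .
  show ?thesis unfolding cond_law_def
  proof (intro conjI ballI hV)
    fix B assume B: "B \<in> sets S"
    define E where "E = h -` B \<inter> space (?R \<Otimes>\<^sub>M P)"
    have E: "E \<in> sets (?R \<Otimes>\<^sub>M P)" unfolding E_def using h' B by (rule measurable_sets)
    \<comment> \<open>The candidate conditional probability: fix the outcome and measure the section
      of the event under \<open>P\<close>. Measurability of section measures makes it
      \<open>F\<close>-measurable.\<close>
    define g where "g \<omega> = measure P (Pair \<omega> -` E)" for \<omega>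
    have g_R: "g \<in> borel_measurable ?R"
      unfolding g_def measure_def
      by (rule measurable_compose[OF P.measurable_emeasure_Pair[OF E]]) simp
    have gF: "g \<in> borel_measurable F"
      using g_R by (simp add: measurable_cong_sets[OF sR refl])
    have gM: "g \<in> borel_measurable M" using measurable_from_subalg[OF sub gF] .
    have g_int: "integrable M g"
      by (rule M.integrable_const_bound[where B=1]) (auto simp: g_def gM)
    let ?f = "indicator ((\<lambda>\<omega>. h (\<omega>, V \<omega>)) -` B \<inter> space M) :: _ \<Rightarrow> real"
    have fset: "(\<lambda>\<omega>. h (\<omega>, V \<omega>)) -` B \<inter> space M \<in> sets M" using hV B by (rule measurable_sets)
    have "AE \<omega> in M. real_cond_exp M F ?f \<omega> = g \<omega>"
    proof (rule S.real_cond_exp_charact)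
      fix A assume A: "A \<in> sets F"
      have AM: "A \<in> sets M" using A sub by (auto simp: subalgebra_def)
      have AR: "A \<in> sets ?R" using A by (simp add: sR)
      \<comment> \<open>The event \<open>A\<close> together with the event that \<open>h\<close>
        lands in \<open>B\<close>, written on the product space so that the joint law and Fubini
        apply.\<close>
      let ?k = "\<lambda>p. indicator A (fst p) * indicator E p :: real"
      have k: "?k \<in> borel_measurable (?R \<Otimes>\<^sub>M P)" using AR E
        by (intro borel_measurable_times borel_measurable_indicator measurable_compose[OF measurable_fst])
      have k_int: "integrable (?R \<Otimes>\<^sub>M P) ?k"
        by (rule RP.integrable_const_bound[where B=1, OF _ k]) (auto simp: indicator_def)
      have "(\<integral>x\<in>A. ?f x \<partial>M) = (\<integral>x. ?k (x, V x) \<partial>M)"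
        unfolding set_lebesgue_integral_def
        using measurable_space[OF pair_meas]
        by (intro Bochner_Integration.integral_cong) (auto simp: indicator_def E_def)
      also have "\<dots> = (\<integral>p. ?k p \<partial>distr M (?R \<Otimes>\<^sub>M P) (\<lambda>\<omega>. (\<omega>, V \<omega>)))"
        using k pair_meas by (subst integral_distr) auto
      also have "\<dots> = (\<integral>p. ?k p \<partial>(?R \<Otimes>\<^sub>M P))"
        by (simp only: cond_law_indep_joint[OF M sub V P sP])
      also have "\<dots> = (\<integral>x. (\<integral>v. ?k (x, v) \<partial>P) \<partial>?R)"
        by (rule RP.integral_fst'[OF k_int, symmetric])
      also have "\<dots> = (\<integral>x. indicator A x * g x \<partial>?R)"
      proof (intro Bochner_Integration.integral_cong refl)
        fix x
        have sec: "Pair x -` E \<in> sets P" using E by (rule sets_Pair1)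
        have "(\<integral>v. ?k (x, v) \<partial>P) = (\<integral>v. indicator A x * indicator (Pair x -` E) v \<partial>P)"
          by (intro Bochner_Integration.integral_cong) (auto simp: indicator_def)
        also have "\<dots> = indicator A x * g x" using sec by (simp add: g_def)
        finally show "(\<integral>v. ?k (x, v) \<partial>P) = indicator A x * g x" .
      qed
      also have "\<dots> = (\<integral>x. indicator A x * g x \<partial>M)"
        using A gF by (intro integral_subalgebra2[OF sub] borel_measurable_times borel_measurable_indicator)
      finally show "(\<integral>x\<in>A. ?f x \<partial>M) = (\<integral>x\<in>A. g x \<partial>M)"
        by (simp add: set_lebesgue_integral_def)
    qed (use fset gF g_int in \<open>auto simp: integrable_indicator_iff M.emeasure_eq_measure\<close>)
    \<comment> \<open>Restricted to \<open>space M\<close>, where the section of \<open>h\<close> is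
      guaranteed to be measurable and the pushforward is meaningful.\<close>
    moreover have "g \<omega> = measure (distr P S (\<lambda>v. h (\<omega>, v))) B" if w: "\<omega> \<in> space M" for \<omega>
    proof -
      have "(\<lambda>v. h (\<omega>, v)) \<in> measurable P S"
        using measurable_compose[OF measurable_Pair1' h'] w by (auto simp: space_restr_to_subalg)
      then have "measure (distr P S (\<lambda>v. h (\<omega>, v))) B = measure P ((\<lambda>v. h (\<omega>, v)) -` B \<inter> space P)"
        using B by (rule measure_distr)
      also have "(\<lambda>v. h (\<omega>, v)) -` B \<inter> space P = Pair \<omega> -` E"
        using w by (auto simp: E_def space_pair_measure space_restr_to_subalg)
      finally show ?thesis by (simp add: g_def)
    qed
    ultimately show "AE \<omega> in M. real_cond_exp M F ?f \<omega> = measure (distr P S (\<lambda>v. h (\<omega>, v))) B"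
      by auto
  qed
qed

section \<open>Normal laws\<close>

lemma prob_space_std_normal: "prob_space (density lborel (\<lambda>x. ennreal (std_normal_density x)))"
  by (rule prob_space_normal_density) simp

lemma sets_normal_law [measurable_cong, simp]: "sets (normal_law v) = sets borel"
  by (simp add: normal_law_def)

lemma prob_space_normal_law: "prob_space (normal_law v)"
  unfolding normal_law_def
  by (intro prob_space.prob_space_distr prob_space_std_normal) simp

lemma normal_law_1: "normal_law 1 = density lborel (\<lambda>x. ennreal (std_normal_density x))"
  unfolding normal_law_def by (simp add: distr_id2 mult_1[abs_def])

text \<open>The density is even and Lebesgue measure is invariant under reflection.\<close>

lemma normal_law_1_uminus: "distr (normal_law 1) borel uminus = normal_law 1"
  using density_distr[of "\<lambda>x. ennreal (std_normal_density x)" borel uminus lborel]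
  by (simp add: normal_law_1 lborel_distr_uminus normal_density_def)

lemma normal_law_scale: "distr (normal_law 1) borel (\<lambda>x. sqrt v * x) = normal_law v"
  by (simp add: normal_law_1) (simp add: normal_law_def)

text \<open>Reflect first and scale afterwards: the reflection leaves the standard normal law
  unchanged.\<close>

lemma normal_law_scale_neg: "distr (normal_law 1) borel (\<lambda>x. - sqrt v * x) = normal_law v"
proof -
  have "distr (normal_law 1) borel (\<lambda>x. - sqrt v * x) =
      distr (distr (normal_law 1) borel uminus) borel (\<lambda>x. sqrt v * x)"
    by (subst distr_distr) (auto simp: comp_def intro!: distr_cong)
  then show ?thesis by (simp add: normal_law_1_uminus normal_law_scale)
qed

text \<open>The preimage of a box under a coordinatewise map is a box, and over a finite index set
  the values on boxes determine the product measure.\<close>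

lemma distr_PiM_finite_coordinatewise:
  assumes fin: "finite I" and p: "\<And>i. i \<in> I \<Longrightarrow> prob_space (M i)"
    and f: "\<And>i. i \<in> I \<Longrightarrow> f i \<in> measurable (M i) (N i)"
  shows "distr (PiM I M) (PiM I N) (\<lambda>z. \<lambda>i\<in>I. f i (z i)) = PiM I (\<lambda>i. distr (M i) (N i) (f i))"
proof -
  \<comment> \<open>\<open>product_prob_space\<close> asks for a probability space at every index,
    so both families are padded outside \<open>I\<close> by a point mass; the products over
    \<open>I\<close> stay the same.\<close>
  define M' where "M' i = (if i \<in> I then M i else return (count_space UNIV) undefined)" for i
  have pM': "prob_space (M' i)" for i by (auto simp: M'_def p intro!: prob_space_return)
  have M'_eq: "PiM I M' = PiM I M" by (intro PiM_cong) (simp_all add: M'_def)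
  define D where "D i = (if i \<in> I then distr (M i) (N i) (f i) else return (count_space UNIV) undefined)" for i
  have pD: "prob_space (D i)" for i
    by (auto simp: D_def p f intro!: prob_space_return prob_space.prob_space_distr)
  have D_eq: "PiM I D = PiM I (\<lambda>i. distr (M i) (N i) (f i))" by (intro PiM_cong) (simp_all add: D_def)
  interpret M': product_prob_space M' by (rule product_prob_spaceI) (rule pM')
  interpret D: product_prob_space D by (rule product_prob_spaceI) (rule pD)
  have sets_D: "sets (PiM I N) = sets (PiM I D)" by (rule sets_PiM_cong) (simp_all add: D_def)
  have meas: "(\<lambda>z. \<lambda>i\<in>I. f i (z i)) \<in> measurable (PiM I M) (PiM I N)"
    by (rule measurable_restrict) (rule measurable_compose[OF measurable_component_singleton], auto intro: f)
  have "distr (PiM I M) (PiM I N) (\<lambda>z. \<lambda>i\<in>I. f i (z i)) = PiM I D"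
  proof (rule D.PiM_eqI[OF fin])
    show "sets (distr (PiM I M) (PiM I N) (\<lambda>z. \<lambda>i\<in>I. f i (z i))) = sets (PiM I D)"
      by (simp add: sets_D)
  next
    fix A assume A: "\<And>i. i \<in> I \<Longrightarrow> A i \<in> sets (D i)"
    have AN: "A i \<in> sets (N i)" if "i \<in> I" for i using A[OF that] that by (simp add: D_def)
    have pre: "f i -` A i \<inter> space (M i) \<in> sets (M i)" if "i \<in> I" for i
      using f[OF that] AN[OF that] by (rule measurable_sets)
    have "(\<lambda>z. \<lambda>i\<in>I. f i (z i)) -` Pi\<^sub>E I A \<inter> space (PiM I M) =
        Pi\<^sub>E I (\<lambda>i. f i -` A i \<inter> space (M i))"
      by (auto simp: space_PiM PiE_iff)
    then have "emeasure (distr (PiM I M) (PiM I N) (\<lambda>z. \<lambda>i\<in>I. f i (z i))) (Pi\<^sub>E I A) =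
        emeasure (PiM I M) (Pi\<^sub>E I (\<lambda>i. f i -` A i \<inter> space (M i)))"
      using AN fin by (subst emeasure_distr[OF meas]) (auto intro!: sets_PiM_I_finite)
    also have "\<dots> = (\<Prod>i\<in>I. emeasure (M' i) (f i -` A i \<inter> space (M i)))"
      unfolding M'_eq[symmetric] using fin pre by (intro M'.emeasure_PiM) (auto simp: M'_def)
    also have "\<dots> = (\<Prod>i\<in>I. emeasure (D i) (A i))"
      using f AN by (intro prod.cong refl) (simp add: M'_def D_def emeasure_distr)
    finally show "emeasure (distr (PiM I M) (PiM I N) (\<lambda>z. \<lambda>i\<in>I. f i (z i))) (Pi\<^sub>E I A) =
      (\<Prod>i\<in>I. emeasure (D i) (A i))" .
  qed
  then show ?thesis by (simp add: D_eq)
qed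

section \<open>Diagonal and isotropic normal vectors\<close>

lemma sets_normal_diag: "sets (normal_diag n v) = sets (\<Pi>\<^sub>M i\<in>{..<n}. borel)"
  unfolding normal_diag_def by (intro sets_PiM_cong) auto

lemma prob_space_normal_diag: "prob_space (normal_diag n v)"
  unfolding normal_diag_def by (intro prob_space_PiM prob_space_normal_law)

lemma normal_diag_scale_neg:
  "distr (normal_diag n (\<lambda>_. 1)) (\<Pi>\<^sub>M i\<in>{..<n}. borel) (\<lambda>z. \<lambda>i\<in>{..<n}. - sqrt (v i) * z i) = normal_diag n v"
proof -
  have "distr (normal_diag n (\<lambda>_. 1)) (\<Pi>\<^sub>M i\<in>{..<n}. borel) (\<lambda>z. \<lambda>i\<in>{..<n}. - sqrt (v i) * z i) =
      (\<Pi>\<^sub>M i\<in>{..<n}. distr (normal_law 1) borel (\<lambda>x. - sqrt (v i) * x))"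
    unfolding normal_diag_def
    by (rule distr_PiM_finite_coordinatewise) (auto intro: prob_space_normal_law)
  then show ?thesis unfolding normal_law_scale_neg by (simp add: normal_diag_def)
qed

lemma measurable_vec_of_PiM:
  "(\<lambda>f. \<chi> j. f j) \<in> measurable (\<Pi>\<^sub>M j\<in>UNIV. normal_law v) (borel :: (real ^ 'd::finite) measure)"
proof (subst borel_measurable_euclidean_space, intro ballI)
  fix b :: "real ^ 'd" assume "b \<in> Basis"
  then obtain j where b: "b = axis j 1" by (auto simp: Basis_vec_def)
  show "(\<lambda>f. (\<chi> j. f j) \<bullet> b) \<in> borel_measurable (\<Pi>\<^sub>M j\<in>UNIV. normal_law v)"
    unfolding b by (simp add: inner_axis)
qed

lemma prob_space_normal_iso: "prob_space (normal_iso v)"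
  unfolding normal_iso_def
  by (intro prob_space.prob_space_distr prob_space_PiM prob_space_normal_law measurable_vec_of_PiM)

lemma sets_normal_iso [simp, measurable_cong]: "sets (normal_iso v) = sets borel"
  by (simp add: normal_iso_def)

text \<open>Scaling commutes with reading a function as a vector, so it can be carried out
  coordinate by coordinate before the identification.\<close>

lemma normal_iso_scale:
  "distr (normal_iso 1) borel (\<lambda>x. sqrt v *\<^sub>R x) = (normal_iso v :: (real ^ 'd::finite) measure)"
proof -
  let ?P1 = "\<Pi>\<^sub>M j\<in>(UNIV :: 'd set). normal_law 1"
  let ?s = "\<lambda>z. \<lambda>j\<in>(UNIV :: 'd set). sqrt v * z j"
  have s: "?s \<in> measurable ?P1 (\<Pi>\<^sub>M j\<in>(UNIV :: 'd set). borel)" by measurable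
  have "distr ?P1 (\<Pi>\<^sub>M j\<in>(UNIV :: 'd set). borel) ?s =
      (\<Pi>\<^sub>M j\<in>UNIV. distr (normal_law 1) borel (\<lambda>x. sqrt v * x))"
    by (rule distr_PiM_finite_coordinatewise) (auto intro: prob_space_normal_law)
  then have P: "distr ?P1 (\<Pi>\<^sub>M j\<in>(UNIV :: 'd set). borel) ?s = (\<Pi>\<^sub>M j\<in>UNIV. normal_law v)"
    by (simp add: normal_law_scale)
  have vec: "(\<lambda>f. \<chi> j. f j) \<in> measurable (\<Pi>\<^sub>M j\<in>(UNIV :: 'd set). borel) (borel :: (real ^ 'd) measure)"
    using measurable_vec_of_PiM[of v]
    by (simp add: measurable_cong_sets[OF sets_PiM_cong[OF refl sets_normal_law] refl])
  have "distr (normal_iso 1) borel (\<lambda>x. sqrt v *\<^sub>R x) =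
      distr ?P1 borel ((\<lambda>x. sqrt v *\<^sub>R x) \<circ> (\<lambda>f. \<chi> j. f j))"
    unfolding normal_iso_def by (rule distr_distr) (auto intro: measurable_vec_of_PiM)
  also have "(\<lambda>x. sqrt v *\<^sub>R x) \<circ> (\<lambda>f. \<chi> j. f j) = (\<lambda>f. \<chi> j. f j) \<circ> ?s"
    by (auto simp: fun_eq_iff vec_eq_iff)
  also have "distr ?P1 borel \<dots> = distr (distr ?P1 (\<Pi>\<^sub>M j\<in>(UNIV :: 'd set). borel) ?s) borel (\<lambda>f. \<chi> j. f j)"
    by (rule distr_distr[symmetric, OF vec s])
  finally show ?thesis unfolding P by (simp add: normal_iso_def)
qed

section \<open>Measurability of the Fisher information\<close>

text \<open>One term of the exponential series is at most the whole sum. This trades a power for a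
  slightly larger exponential rate.\<close>

lemma power_le_fact_mult_exp: "0 \<le> (x::real) \<Longrightarrow> x ^ m \<le> fact m * exp x"
proof -
  assume x: "0 \<le> x"
  have "(\<Sum>n\<in>{m}. x ^ n /\<^sub>R fact n) \<le> exp x"
    unfolding exp_def using x by (intro sum_le_suminf summable_exp_generic) auto
  then show ?thesis by (simp add: field_simps)
qed

text \<open>Both signs follow from \<open>1 + x \<le> exp x\<close>. The bound serves to dominate
  difference quotients of exponentials.\<close>

lemma abs_exp_minus_1_le: "\<bar>exp x - 1\<bar> \<le> \<bar>x\<bar> * exp \<bar>x::real\<bar>"
proof (cases "0 \<le> x")
  case True
  have "(1 - x) * exp x \<le> exp (- x) * exp x"
    using exp_ge_add_one_self[of "- x"] by (intro mult_right_mono) auto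
  then have "exp x - x * exp x \<le> 1" by (simp add: algebra_simps flip: exp_add)
  then show ?thesis using True by simp
next
  case False
  have "1 - exp x \<le> - x" using exp_ge_add_one_self[of x] by linarith
  also have "\<dots> \<le> \<bar>x\<bar> * exp \<bar>x\<bar>" using False mult_left_mono[of 1 "exp \<bar>x\<bar>" "\<bar>x\<bar>"] by simp
  finally show ?thesis using False by simp
qed

text \<open>Left unnormalised: \<open>k = 0\<close> is the moment generating function, and larger
  \<open>k\<close> are its derivatives in the interior of the domain.\<close>

definition tilted_moment :: "real measure \<Rightarrow> nat \<Rightarrow> real \<Rightarrow> real" where
  "tilted_moment Q k u = (\<integral>y. y ^ k * exp (u * y) \<partial>Q)"

lemma finite_frontier_is_interval:
  fixes S :: "real set"
  assumes "is_interval S"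
  shows "finite (frontier S)"
proof -
  have "\<exists>a b. S = {} \<or> S = UNIV \<or> S = {..<b} \<or> S = {..b} \<or> S = {a<..} \<or> S = {a..} \<or>
      S = {a<..<b} \<or> S = {a<..b} \<or> S = {a..<b} \<or> S = {a..b}"
    using assms unfolding is_interval_1 by (intro interval_cases) blast
  then obtain a b where *: "S = {} \<or> S = UNIV \<or> S = {..<b} \<or> S = {..b} \<or> S = {a<..} \<or> S = {a..} \<or>
      S = {a<..<b} \<or> S = {a<..b} \<or> S = {a..<b} \<or> S = {a..b}" by blast
  \<comment> \<open>The frontier is the closure minus the interior, hence lies in
    \<open>C - V\<close> for any closed \<open>C\<close> above and open \<open>V\<close> below; each
    shape of interval leaves only its endpoints.\<close>
  have sandwich: "frontier S \<subseteq> {a, b}" if "open V" "V \<subseteq> S" "S \<subseteq> C" "closed C" "C - V \<subseteq> {a, b}" for V C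
    using that closure_minimal[of S C] interior_maximal[of V S] by (auto simp: frontier_def)
  have "frontier S \<subseteq> {a, b}"
    using *
  proof (elim disjE)
    assume "S = {..<b}" then show ?thesis by (intro sandwich[of "{..<b}" "{..b}"]) auto
  next
    assume "S = {..b}" then show ?thesis by (intro sandwich[of "{..<b}" "{..b}"]) auto
  next
    assume "S = {a<..}" then show ?thesis by (intro sandwich[of "{a<..}" "{a..}"]) auto
  next
    assume "S = {a..}" then show ?thesis by (intro sandwich[of "{a<..}" "{a..}"]) auto
  qed (simp, simp, (rule sandwich[of "{a<..<b}" "{a..b}"]; auto)+)
  then show ?thesis by (rule finite_subset) simp
qed

context
  fixes Q :: "real measure"
  assumes Q: "prob_space Q" and sQ: "sets Q = sets borel"
begin

interpretation prob_space Q by (rule Q)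

section \<open>Domain of the cumulant-generating function and smoothness of tilted moments\<close>

lemma borel_Q: "f \<in> borel_measurable borel \<Longrightarrow> f \<in> borel_measurable Q"
  for f :: "real \<Rightarrow> 'a::topological_space"
  by (simp add: measurable_cong_sets[OF sQ refl])

lemma mem_cgf_dom_iff: "u \<in> cgf_dom Q \<longleftrightarrow> integrable Q (\<lambda>y. exp (u * y))"
proof -
  have "integrable Q (\<lambda>y. exp (u * y)) \<longleftrightarrow> (\<integral>\<^sup>+y. ennreal (exp (u * y)) \<partial>Q) < \<infinity>"
    by (auto simp: integrable_iff_bounded intro!: borel_Q)
  then show ?thesis by (auto simp: cgf_dom_def cgf_def Let_def less_top)
qed

lemma cgf_eq_ln:
  assumes "u \<in> cgf_dom Q"
  shows "cgf Q u = ereal (ln (tilted_moment Q 0 u))"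
proof -
  have i: "integrable Q (\<lambda>y. exp (u * y))" using assms by (simp add: mem_cgf_dom_iff)
  have "(\<integral>\<^sup>+y. ennreal (exp (u * y)) \<partial>Q) = ennreal (tilted_moment Q 0 u)"
    using nn_integral_eq_integral[OF i] by (simp add: tilted_moment_def)
  then show ?thesis by (simp add: cgf_def tilted_moment_def integral_nonneg_AE)
qed

text \<open>A strictly positive integrand with integral zero would vanish almost everywhere, which
  is impossible under a probability measure.\<close>

lemma tilted_moment_0_pos:
  assumes "u \<in> cgf_dom Q"
  shows "tilted_moment Q 0 u > 0"
proof -
  have i: "integrable Q (\<lambda>y. exp (u * y))" using assms by (simp add: mem_cgf_dom_iff)
  have "tilted_moment Q 0 u \<noteq> 0"
  proof
    assume "tilted_moment Q 0 u = 0"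
    then have "AE y in Q. exp (u * y) = 0"
      using integral_nonneg_eq_0_iff_AE[OF i] by (simp add: tilted_moment_def)
    then show False by simp
  qed
  moreover have "tilted_moment Q 0 u \<ge> 0" by (simp add: tilted_moment_def)
  ultimately show ?thesis by simp
qed

text \<open>Between two parameters the exponential is bounded by the one at the right endpoint for
  \<open>y \<ge> 0\<close> and at the left endpoint for \<open>y < 0\<close>, hence always by their
  sum.\<close>

lemma is_interval_cgf_dom: "is_interval (cgf_dom Q)"
  unfolding is_interval_1
proof (intro ballI allI impI)
  fix p q u assume "p \<in> cgf_dom Q" "q \<in> cgf_dom Q" and u: "p \<le> u \<and> u \<le> q"
  then have i: "integrable Q (\<lambda>y. exp (p * y) + exp (q * y))" by (simp add: mem_cgf_dom_iff)
  have "exp (u * y) \<le> exp (p * y) + exp (q * y)" for y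
  proof (cases "0 \<le> y")
    case True
    then have "exp (u * y) \<le> exp (q * y)" using u by (simp add: mult_right_mono)
    then show ?thesis using exp_gt_zero[of "p * y"] by linarith
  next
    case False
    then have "exp (u * y) \<le> exp (p * y)" using u by (simp add: mult_right_mono_neg)
    then show ?thesis using exp_gt_zero[of "q * y"] by linarith
  qed
  then have "integrable Q (\<lambda>y. exp (u * y))"
    by (intro Bochner_Integration.integrable_bound[OF i]) (auto intro!: borel_Q simp: add_nonneg_nonneg)
  then show "u \<in> cgf_dom Q" by (simp add: mem_cgf_dom_iff)
qed

text \<open>Supplies the dominating functions for differentiating every tilted moment, with one rate
  \<open>r\<close> for all orders.\<close>

lemma ex_integrable_tilted_dominant:
  assumes "u \<in> interior (cgf_dom Q)"
  shows "\<exists>r>0. \<forall>m. integrable Q (\<lambda>y. \<bar>y\<bar> ^ m * exp (u * y + r * \<bar>y\<bar>))"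
proof -
  obtain e where e: "e > 0" "cball u e \<subseteq> cgf_dom Q"
    using assms unfolding mem_interior_cball by blast
  \<comment> \<open>The rate is spent twice, once in the dominating function and once to absorb the
    power of \<open>\<bar>y\<bar>\<close>; \<open>u + 2 * r\<close> and \<open>u - 2 * r\<close>
    still lie in \<open>cball u e\<close>.\<close>
  define r where "r = e / 2"
  have r: "r > 0" using e by (simp add: r_def)
  have "integrable Q (\<lambda>y. \<bar>y\<bar> ^ m * exp (u * y + r * \<bar>y\<bar>))" for m
  proof -
    define C where "C = fact m / r ^ m"
    have C: "C > 0" using r by (simp add: C_def)
    have "u + 2 * r \<in> cgf_dom Q" "u - 2 * r \<in> cgf_dom Q"
      using e by (auto simp: r_def dist_real_def intro!: subsetD[OF e(2)])
    then have i: "integrable Q (\<lambda>y. C * (exp ((u + 2 * r) * y) + exp ((u - 2 * r) * y)))"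
      by (simp add: mem_cgf_dom_iff)
    have "\<bar>y\<bar> ^ m * exp (u * y + r * \<bar>y\<bar>) \<le> C * (exp ((u + 2 * r) * y) + exp ((u - 2 * r) * y))" for y
    proof -
      have "(r * \<bar>y\<bar>) ^ m \<le> fact m * exp (r * \<bar>y\<bar>)" using r by (intro power_le_fact_mult_exp) simp
      then have "\<bar>y\<bar> ^ m \<le> C * exp (r * \<bar>y\<bar>)"
        using r by (simp add: C_def field_simps power_mult_distrib)
      then have "\<bar>y\<bar> ^ m * exp (u * y + r * \<bar>y\<bar>) \<le> C * exp (r * \<bar>y\<bar>) * exp (u * y + r * \<bar>y\<bar>)"
        by (rule mult_right_mono) simp
      also have "\<dots> = C * exp (u * y + 2 * r * \<bar>y\<bar>)"
        by (simp add: mult_exp_exp algebra_simps)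
      also have "exp (u * y + 2 * r * \<bar>y\<bar>) \<le> exp ((u + 2 * r) * y) + exp ((u - 2 * r) * y)"
        by (cases "0 \<le> y") (auto simp: algebra_simps)
      finally show ?thesis using C by simp
    qed
    then show ?thesis
      using C by (intro Bochner_Integration.integrable_bound[OF i]) (auto intro!: borel_Q simp: add_nonneg_nonneg)
  qed
  with r show ?thesis by blast
qed

text \<open>Differentiation under the integral sign, by dominated convergence along an arbitrary
  sequence of nonzero increments tending to 0.\<close>

lemma tilted_moment_has_derivative:
  assumes "u \<in> interior (cgf_dom Q)"
  shows "(tilted_moment Q k has_real_derivative tilted_moment Q (Suc k) u) (at u)"
proof -
  obtain r where r: "r > 0" and dom: "\<And>m. integrable Q (\<lambda>y. \<bar>y\<bar> ^ m * exp (u * y + r * \<bar>y\<bar>))"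
    using ex_integrable_tilted_dominant[OF assms] by blast
  have i: "integrable Q (\<lambda>y. y ^ m * exp ((u + h) * y))" if h: "\<bar>h\<bar> \<le> r" for m h
  proof (rule Bochner_Integration.integrable_bound[OF dom[of m]])
    have "(u + h) * y \<le> u * y + r * \<bar>y\<bar>" for y
    proof -
      have "h * y \<le> \<bar>h\<bar> * \<bar>y\<bar>" using abs_ge_self[of "h * y"] by (simp add: abs_mult)
      also have "\<dots> \<le> r * \<bar>y\<bar>" using h by (simp add: mult_right_mono)
      finally show ?thesis by (simp add: algebra_simps)
    qed
    then show "AE y in Q. norm (y ^ m * exp ((u + h) * y)) \<le> norm (\<bar>y\<bar> ^ m * exp (u * y + r * \<bar>y\<bar>))"
      by (auto simp: abs_mult power_abs intro!: mult_left_mono)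
  qed (auto intro!: borel_Q)
  show ?thesis unfolding DERIV_def tendsto_at_iff_sequentially
  proof (intro allI impI)
    fix X :: "nat \<Rightarrow> real" assume "\<forall>n. X n \<in> UNIV - {0}" and X: "X \<longlonglongrightarrow> 0"
    then have X0: "X n \<noteq> 0" for n by auto
    \<comment> \<open>The dominating function controls the quotients for increments below
      \<open>r\<close>, hence the shift of the sequence by \<open>N\<close>.\<close>
    obtain N where N: "\<And>n. n \<ge> N \<Longrightarrow> \<bar>X n\<bar> < r"
      using LIMSEQ_D[OF X r] by auto
    let ?q = "\<lambda>n y. (y ^ k * exp ((u + X n) * y) - y ^ k * exp (u * y)) / X n"
    have "(\<lambda>n. \<integral>y. ?q (n + N) y \<partial>Q) \<longlonglongrightarrow> (\<integral>y. y ^ Suc k * exp (u * y) \<partial>Q)"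
    proof (rule integral_dominated_convergence[OF _ _ dom[of "Suc k"]])
      show "AE y in Q. (\<lambda>n. ?q (n + N) y) \<longlonglongrightarrow> y ^ Suc k * exp (u * y)"
      proof (rule AE_I2)
        fix y
        have "((\<lambda>v. y ^ k * exp (v * y)) has_real_derivative y ^ Suc k * exp (u * y)) (at u)"
          by (auto intro!: derivative_eq_intros)
        then have "(\<lambda>n. ?q n y) \<longlonglongrightarrow> y ^ Suc k * exp (u * y)"
          unfolding DERIV_def tendsto_at_iff_sequentially using X X0 by (auto simp: comp_def)
        then show "(\<lambda>n. ?q (n + N) y) \<longlonglongrightarrow> y ^ Suc k * exp (u * y)"
          by (rule LIMSEQ_ignore_initial_segment)
      qed
      show "AE y in Q. norm (?q (n + N) y) \<le> \<bar>y\<bar> ^ Suc k * exp (u * y + r * \<bar>y\<bar>)" for n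
      proof (rule AE_I2)
        fix y
        define h where "h = X (n + N)"
        have h: "h \<noteq> 0" "\<bar>h\<bar> < r" using X0 N by (auto simp: h_def)
        have "\<bar>exp (h * y) - 1\<bar> \<le> \<bar>h * y\<bar> * exp \<bar>h * y\<bar>" by (rule abs_exp_minus_1_le)
        also have "\<dots> \<le> \<bar>h * y\<bar> * exp (r * \<bar>y\<bar>)"
          using h by (intro mult_left_mono) (auto simp: abs_mult intro!: mult_right_mono)
        finally have b: "\<bar>exp (h * y) - 1\<bar> / \<bar>h\<bar> \<le> \<bar>y\<bar> * exp (r * \<bar>y\<bar>)"
          using h by (simp add: abs_mult field_simps)
        have "?q (n + N) y = (y ^ k * exp (u * y)) * ((exp (h * y) - 1) / h)"
          by (simp add: h_def algebra_simps exp_add diff_divide_distrib)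
        then have "norm (?q (n + N) y) = \<bar>y\<bar> ^ k * exp (u * y) * (\<bar>exp (h * y) - 1\<bar> / \<bar>h\<bar>)"
          by (simp add: abs_mult power_abs)
        also have "\<dots> \<le> \<bar>y\<bar> ^ k * exp (u * y) * (\<bar>y\<bar> * exp (r * \<bar>y\<bar>))"
          by (rule mult_left_mono[OF b]) simp
        finally show "norm (?q (n + N) y) \<le> \<bar>y\<bar> ^ Suc k * exp (u * y + r * \<bar>y\<bar>)"
          by (simp add: exp_add mult_ac)
      qed
    qed (auto intro!: borel_Q)
    also have "(\<lambda>n. \<integral>y. ?q (n + N) y \<partial>Q) =
        (\<lambda>n. (tilted_moment Q k (u + X (n + N)) - tilted_moment Q k u) / X (n + N))"
    proof
      fix n
      have "\<bar>X (n + N)\<bar> \<le> r" using N[of "n + N"] by simp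
      then show "(\<integral>y. ?q (n + N) y \<partial>Q) =
          (tilted_moment Q k (u + X (n + N)) - tilted_moment Q k u) / X (n + N)"
        using i[of "X (n + N)" k] i[of 0 k] r by (simp add: tilted_moment_def)
    qed
    finally show "((\<lambda>h. (tilted_moment Q k (u + h) - tilted_moment Q k u) / h) \<circ> X)
        \<longlonglongrightarrow> tilted_moment Q (Suc k) u"
      unfolding comp_def tilted_moment_def[of Q "Suc k"] by (rule LIMSEQ_offset)
  qed
qed

lemma borel_measurable_tilted_moment: "tilted_moment Q k \<in> borel_measurable borel"
proof -
  have "(\<lambda>(u, y). y ^ k * exp (u * y) :: real) \<in> borel_measurable (borel \<Otimes>\<^sub>M borel)" by measurable
  then have "(\<lambda>(u, y). y ^ k * exp (u * y)) \<in> borel_measurable (borel \<Otimes>\<^sub>M Q)"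
    by (simp add: measurable_cong_sets[OF sets_pair_measure_cong[OF refl sQ] refl])
  then show ?thesis unfolding tilted_moment_def by (rule borel_measurable_lebesgue_integral)
qed

section \<open>Fisher information inside and outside the domain\<close>

lemma prob_space_ef:
  assumes "u \<in> cgf_dom Q"
  shows "prob_space (ef Q u)"
proof
  let ?m = "tilted_moment Q 0 u"
  have i: "integrable Q (\<lambda>y. exp (u * y))" using assms by (simp add: mem_cgf_dom_iff)
  have m: "?m > 0" by (rule tilted_moment_0_pos[OF assms])
  have dens: "ef_density Q y u = exp (u * y) / ?m" for y
    using m by (simp add: ef_density_def cgf_eq_ln[OF assms] exp_diff mult.commute)
  have "emeasure (ef Q u) (space (ef Q u)) = (\<integral>\<^sup>+y. ennreal (exp (u * y) / ?m) \<partial>Q)"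
    unfolding ef_def by (subst emeasure_density) (auto simp: dens intro!: borel_Q nn_integral_cong)
  also have "\<dots> = ennreal (\<integral>y. exp (u * y) / ?m \<partial>Q)"
    using i m by (intro nn_integral_eq_integral) auto
  also have "(\<integral>y. exp (u * y) / ?m \<partial>Q) = 1" using m by (simp add: tilted_moment_def)
  finally show "emeasure (ef Q u) (space (ef Q u)) = 1" by simp
qed

text \<open>The negative log-density differs from the cumulant-generating function by a term linear
  in the parameter, so its second derivative does not see \<open>y\<close>. The first derivative is
  wanted on an open set because it is differentiated again.\<close>

lemma deriv2_ln_inverse_ef_density:
  assumes "open S" "u \<in> S"
    and d: "\<And>v. v \<in> S \<Longrightarrow> ((\<lambda>v. real_of_ereal (cgf Q v)) has_real_derivative f v) (at v)"
    and d2: "(f has_real_derivative D) (at u)"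
  shows "(deriv ^^ 2) (\<lambda>v. ln (1 / ef_density Q y v)) u = D"
proof -
  have eq: "(\<lambda>v. ln (1 / ef_density Q y v)) = (\<lambda>v. real_of_ereal (cgf Q v) - y * v)"
    by (simp add: ef_density_def ln_div fun_eq_iff)
  have "deriv (\<lambda>v. real_of_ereal (cgf Q v) - y * v) v = f v - y" if "v \<in> S" for v
    using d[OF that] by (intro DERIV_imp_deriv) (auto intro!: derivative_eq_intros)
  then have "eventually (\<lambda>v. deriv (\<lambda>v. real_of_ereal (cgf Q v) - y * v) v = f v - y) (nhds u)"
    using assms(1,2) by (auto simp: eventually_nhds)
  then have "deriv (deriv (\<lambda>v. real_of_ereal (cgf Q v) - y * v)) u = deriv (\<lambda>v. f v - y) u"
    by (rule deriv_cong_ev) simp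
  also have "\<dots> = D"
    using d2 by (intro DERIV_imp_deriv) (auto intro!: derivative_eq_intros)
  finally show ?thesis by (simp add: eq numeral_2_eq_2)
qed

text \<open>The quotient rule for the second derivative of the logarithm of the moment generating
  function; the result is the variance of the tilted law.\<close>

lemma fisher_interior_cgf_dom:
  assumes u: "u \<in> interior (cgf_dom Q)"
  shows "fisher Q u = (tilted_moment Q 2 u * tilted_moment Q 0 u - (tilted_moment Q 1 u)\<^sup>2) /
    (tilted_moment Q 0 u)\<^sup>2" (is "_ = ?D")
proof -
  let ?S = "interior (cgf_dom Q)"
  let ?m = "tilted_moment Q"
  have in_dom: "v \<in> cgf_dom Q" if "v \<in> ?S" for v using that interior_subset by blast
  \<comment> \<open>Total mass 1 makes the integral of the constant integrand equal to that
    constant.\<close>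
  interpret ef: prob_space "ef Q u" by (rule prob_space_ef[OF in_dom[OF u]])
  have "((\<lambda>v. real_of_ereal (cgf Q v)) has_real_derivative ?m 1 v / ?m 0 v) (at v)" if v: "v \<in> ?S" for v
  proof (rule has_field_derivative_transform_within_open[OF _ open_interior v])
    show "((\<lambda>v. ln (?m 0 v)) has_real_derivative ?m 1 v / ?m 0 v) (at v)"
      using tilted_moment_0_pos[OF in_dom[OF v]]
      by (auto intro!: derivative_eq_intros tilted_moment_has_derivative[OF v])
  qed (simp add: cgf_eq_ln in_dom)
  moreover have "((\<lambda>v. ?m 1 v / ?m 0 v) has_real_derivative ?D) (at u)"
    using tilted_moment_0_pos[OF in_dom[OF u]]
    by (auto intro!: derivative_eq_intros tilted_moment_has_derivative[OF u]
      simp: power2_eq_square numeral_2_eq_2)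
  ultimately have "(deriv ^^ 2) (\<lambda>v. ln (1 / ef_density Q y v)) u = ?D" for y
    using u by (intro deriv2_ln_inverse_ef_density[OF open_interior]) auto
  then show ?thesis by (simp add: fisher_def ef.prob_space)
qed

text \<open>Here \<open>cgf\<close> is infinite on a whole neighbourhood and
  \<open>real_of_ereal\<close> sends infinity to 0, so the function being differentiated is locally
  constant up to a linear term.\<close>

lemma fisher_outside_closure_cgf_dom:
  assumes u: "u \<notin> closure (cgf_dom Q)"
  shows "fisher Q u = 0"
proof -
  let ?S = "- closure (cgf_dom Q)"
  have "((\<lambda>v. real_of_ereal (cgf Q v)) has_real_derivative 0) (at v)" if v: "v \<in> ?S" for v
  proof (rule has_field_derivative_transform_within_open[OF _ _ v])
    show "((\<lambda>v. 0) has_real_derivative 0) (at v)" by simp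
    show "open ?S" by (rule open_Compl) simp
    show "0 = real_of_ereal (cgf Q x)" if "x \<in> ?S" for x
    proof -
      have "x \<notin> cgf_dom Q" using that closure_subset by blast
      then show ?thesis by (simp add: cgf_dom_def)
    qed
  qed
  then have "(deriv ^^ 2) (\<lambda>v. ln (1 / ef_density Q y v)) u = 0" for y
    using u by (intro deriv2_ln_inverse_ef_density[of ?S _ "\<lambda>_. 0"]) auto
  then show ?thesis by (simp add: fisher_def)
qed

lemma borel_measurable_fisher: "fisher Q \<in> borel_measurable borel"
proof -
  let ?m = "tilted_moment Q" and ?S = "interior (cgf_dom Q)"
  let ?g = "\<lambda>u. indicator ?S u * ((?m 2 u * ?m 0 u - (?m 1 u)\<^sup>2) / (?m 0 u)\<^sup>2)"
  note borel_measurable_tilted_moment [measurable]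
  have g: "?g \<in> borel_measurable borel" by measurable
  have "fisher Q u = ?g u" if "u \<notin> frontier (cgf_dom Q)" for u
    using that fisher_interior_cgf_dom fisher_outside_closure_cgf_dom
    by (cases "u \<in> ?S") (auto simp: frontier_def)
  then show ?thesis
    using finite_frontier_is_interval[OF is_interval_cgf_dom]
    by (intro measurable_discrete_difference[OF g, of "frontier (cgf_dom Q)"])
      (auto intro: countable_finite)
qed

section \<open>Rewards lie in the support of the base distribution\<close>

lemma emeasure_Compl_supp: "emeasure Q (- supp Q) = 0"
proof -
  let ?F = "{S. open S \<and> emeasure Q S = 0}"
  have *: "- supp Q = \<Union>?F" by (auto simp: supp_def)
  \<comment> \<open>The complement of the support is a possibly uncountable union of open null sets;
    the Lindelof property reduces it to a countable one.\<close>
  obtain F' where F': "F' \<subseteq> ?F" "countable F'" "\<Union>F' = \<Union>?F"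
    using Lindelof[of ?F] by blast
  have "(\<Union>S\<in>F'. S) \<in> null_sets Q"
    using F' by (intro null_sets_UN') (auto simp: null_sets_def sQ)
  then show ?thesis using F'(3) by (simp add: * null_sets_def)
qed

lemma open_Compl_supp: "open (- supp Q)"
proof -
  have "- supp Q = \<Union>{S. open S \<and> emeasure Q S = 0}" by (auto simp: supp_def)
  then show ?thesis by auto
qed

text \<open>Null sets of \<open>Q\<close> stay null under any measure with a density with respect to
  \<open>Q\<close>.\<close>

lemma measure_ef_Compl_supp: "measure (ef Q u) (- supp Q) = 0"
proof -
  have dens: "(\<lambda>y. ennreal (ef_density Q y u)) \<in> borel_measurable Q"
    unfolding ef_density_def by (intro borel_Q) measurable
  have null: "- supp Q \<in> null_sets Q"
    using open_Compl_supp emeasure_Compl_supp by (auto simp: null_sets_def sQ)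
  then have "- supp Q \<in> null_sets (ef Q u)"
    unfolding ef_def null_sets_density_iff[OF dens] using AE_not_in[OF null] by auto
  then show ?thesis by (simp add: measure_def null_sets_def)
qed

text \<open>The conditional probability of missing the support vanishes almost surely, and its
  expectation is the unconditional probability.\<close>

lemma AE_reward_in_supp:
  assumes M: "prob_space M" and sub: "subalgebra M G"
    and Y: "cond_law M G borel Y (\<lambda>\<omega>. ef Q (u \<omega>))"
  shows "AE \<omega> in M. Y \<omega> \<in> supp Q"
proof -
  interpret M: prob_space M by fact
  interpret S: finite_measure_subalgebra M G by unfold_locales (rule sub)
  let ?A = "Y -` (- supp Q) \<inter> space M"
  have Ym: "Y \<in> borel_measurable M" using Y by (simp add: cond_law_def)
  have A: "?A \<in> sets M" using Ym open_Compl_supp by (intro measurable_sets) auto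
  have int: "integrable M (indicator ?A :: _ \<Rightarrow> real)"
    using A by (auto simp: integrable_indicator_iff M.emeasure_eq_measure)
  have "AE \<omega> in M. real_cond_exp M G (indicator ?A) \<omega> = 0"
    using Y borel_open[OF open_Compl_supp] by (auto simp: cond_law_def measure_ef_Compl_supp)
  then have "(\<integral>\<omega>. real_cond_exp M G (indicator ?A) \<omega> \<partial>M) = 0" by (rule integral_eq_zero_AE)
  then have "measure M ?A = 0" using S.real_cond_exp_int(2)[OF int] A by simp
  then have "?A \<in> null_sets M" using A by (simp add: null_sets_def M.emeasure_eq_measure)
  then show ?thesis by (rule AE_I') auto
qed

end

section \<open>Reduction of EVILL to perturbed rewards\<close>

lemma loss_ext_perturb:
  assumes "\<And>i. i < length D \<Longrightarrow> snd (D ! i) \<in> supp Q"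
  shows "loss_ext Q lam (perturb D z) \<eta> + ereal (v \<bullet> \<eta>) =
    loss Q lam D \<eta> + ereal ((v - (\<Sum>i<length D. z i *\<^sub>R fst (D ! i))) \<bullet> \<eta>)"
proof -
  let ?x = "\<lambda>i. fst (D ! i)" and ?y = "\<lambda>i. snd (D ! i)"
  have ext: "(\<Sum>(x, y)\<leftarrow>perturb D z. nll_ext Q y (x \<bullet> \<eta>)) =
      (\<Sum>i<length D. nll_ext Q (?y i + z i) (?x i \<bullet> \<eta>))"
    by (simp add: perturb_def comp_def interv_sum_list_conv_sum_set_nat atLeast0LessThan)
  have "(\<Sum>(x, y)\<leftarrow>D. nll Q y (x \<bullet> \<eta>)) = (\<Sum>i<length D. nll Q (?y i) (?x i \<bullet> \<eta>))"
    by (simp add: sum_list_sum_nth atLeast0LessThan case_prod_beta)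
  \<comment> \<open>The linear terms are finite, so the identity also holds in extended reals where
    \<open>cgf\<close> is infinite. Membership in the support selects the finite branch of
    \<open>nll\<close>.\<close>
  moreover have "nll_ext Q (?y i + z i) (?x i \<bullet> \<eta>) =
      nll Q (?y i) (?x i \<bullet> \<eta>) + ereal (- z i * (?x i \<bullet> \<eta>))" if "i < length D" for i
    using assms[OF that] by (cases "cgf Q (?x i \<bullet> \<eta>)") (auto simp: nll_def nll_ext_def algebra_simps)
  ultimately have "(\<Sum>(x, y)\<leftarrow>perturb D z. nll_ext Q y (x \<bullet> \<eta>)) =
      (\<Sum>(x, y)\<leftarrow>D. nll Q y (x \<bullet> \<eta>)) + ereal (\<Sum>i<length D. - z i * (?x i \<bullet> \<eta>))"
    by (simp add: ext sum.distrib)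
  moreover have "(v - (\<Sum>i<length D. z i *\<^sub>R ?x i)) \<bullet> \<eta> =
      (\<Sum>i<length D. - z i * (?x i \<bullet> \<eta>)) + v \<bullet> \<eta>"
    by (simp add: inner_diff_left inner_sum_left sum_negf)
  ultimately show ?thesis
    by (simp add: loss_def loss_ext_def add.assoc)
qed

section \<open>The observed past and the joint law of the perturbations\<close>

lemma length_history [simp]: "length (history X Y t \<omega>) = t"
  by (simp add: history_def)

lemma nth_history [simp]: "i < t \<Longrightarrow> history X Y t \<omega> ! i = (X i \<omega>, Y i \<omega>)"
  by (simp add: history_def)

lemma interaction_subalgebra_mono:
  assumes "interaction M Q arms \<theta>s F G X Y" "s \<le> t"
  shows "subalgebra (F t) (F s)"
proof -
  have "sets (F n) \<subseteq> sets (F (Suc n))" for n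
  proof -
    have "sets (F n) \<subseteq> sets (G n)" "sets (G n) \<subseteq> sets (F (Suc n))"
      using assms(1) by (simp_all add: interaction_def subalgebra_def)
    then show ?thesis by (rule subset_trans)
  qed
  then have "sets (F s) \<subseteq> sets (F t)"
    using assms(2) by (rule lift_Suc_mono_le)
  moreover have "space (F n) = space M" for n
    using assms(1) by (simp add: interaction_def subalgebra_def)
  ultimately show ?thesis by (simp add: subalgebra_def)
qed

text \<open>An arm chosen in round \<open>i\<close> is known in \<open>G i\<close>, hence in
  \<open>F (Suc i)\<close>; \<open>i < t\<close> leaves just enough room to reach
  \<open>F t\<close>.\<close>

lemma interaction_past_arm_measurable:
  assumes "interaction M Q arms \<theta>s F G X Y" "i < t"
  shows "X i \<in> borel_measurable (F t)"
proof -
  have "X i \<in> borel_measurable (G i)" "subalgebra (F (Suc i)) (G i)"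
    using assms(1) by (auto simp: interaction_def)
  then have "X i \<in> borel_measurable (F (Suc i))" by (rule measurable_from_subalg[rotated])
  moreover have "subalgebra (F t) (F (Suc i))"
    using assms by (intro interaction_subalgebra_mono) auto
  ultimately show ?thesis by (rule measurable_from_subalg[rotated])
qed

text \<open>A map acting separately on two factors sends a product measure to the product of the
  pushforwards: the ridge noise and the reward noise stay independent.\<close>

lemma distr_normal_iso_diag:
  "distr (normal_iso 1 \<Otimes>\<^sub>M normal_diag n (\<lambda>_. 1)) (borel \<Otimes>\<^sub>M (\<Pi>\<^sub>M i\<in>{..<n}. borel))
     (\<lambda>(x, z). (sqrt s *\<^sub>R x, \<lambda>i\<in>{..<n}. - sqrt (v i) * z i)) =
   normal_iso s \<Otimes>\<^sub>M normal_diag n v"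
proof -
  have z: "(\<lambda>z. \<lambda>i\<in>{..<n}. - sqrt (v i) * z i) \<in>
      measurable (normal_diag n (\<lambda>_. 1)) (\<Pi>\<^sub>M i\<in>{..<n}. borel)"
    unfolding measurable_cong_sets[OF sets_normal_diag refl] by measurable
  have "sigma_finite_measure (distr (normal_diag n (\<lambda>_. 1)) (\<Pi>\<^sub>M i\<in>{..<n}. borel)
      (\<lambda>z. \<lambda>i\<in>{..<n}. - sqrt (v i) * z i))"
    unfolding normal_diag_scale_neg by (intro prob_space_imp_sigma_finite prob_space_normal_diag)
  from pair_measure_distr[OF _ z this, of "\<lambda>x. sqrt s *\<^sub>R x" "normal_iso 1" borel]
  show ?thesis
    unfolding normal_diag_scale_neg normal_iso_scale by (rule sym) measurable
qed

theorem proposition2: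
  fixes M :: "'w measure" and Q :: "real measure" and U :: "real set"
    and arms \<Theta>' :: "(real ^ 'd::finite) set" and \<theta>s :: "real ^ 'd"
    and lam a :: real
    and est :: "'d dataset \<Rightarrow> real ^ 'd"
    and F G :: "nat \<Rightarrow> 'w measure"
    and \<xi> \<theta> X :: "nat \<Rightarrow> 'w \<Rightarrow> real ^ 'd"
    and \<xi>' :: "nat \<Rightarrow> 'w \<Rightarrow> nat \<Rightarrow> real"
    and Y :: "nat \<Rightarrow> 'w \<Rightarrow> real"
  assumes "glm_bandit Q U arms \<theta>s"
    and "lam > 0" and "a > 0"
    and "evill_run M Q arms \<theta>s lam a \<Theta>' est F G \<xi> \<xi>' \<theta> X Y"
  shows "\<exists>Z. glm_phe_run M Q arms \<theta>s lam \<Theta>'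
           (\<lambda>D. normal_diag (length D) (\<lambda>i. a\<^sup>2 * fisher Q (fst (D ! i) \<bullet> est D)))
           (normal_iso (a\<^sup>2 * lam))
           F G Z (\<lambda>t \<omega>. (a * sqrt lam) *\<^sub>R \<xi> t \<omega>) \<theta> X Y"
proof -
  interpret glm_bandit Q U arms \<theta>s by fact
  note fisher_meas = borel_measurable_fisher[OF prob_Q sets_Q]
  have inter: "interaction M Q arms \<theta>s F G X Y" and opt: "plays_optimal M Q arms \<theta> X"
    using assms(4) by (auto simp: evill_run_def)
  have M: "prob_space M" using inter by (simp add: interaction_def)
  have subF: "subalgebra M (F t)" and subG: "subalgebra M (G t)" and subGF: "subalgebra (G t) (F t)" for t
    using inter by (auto simp: interaction_def)
  let ?H = "history X Y"
  \<comment> \<open>The conditional variance of the perturbation of reward \<open>i\<close>. It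
    depends on \<open>t\<close> as well, since the estimate is recomputed in every round.\<close>
  define c where "c t i \<omega> = a\<^sup>2 * fisher Q (X i \<omega> \<bullet> est (?H t \<omega>))" for t i \<omega>
  \<comment> \<open>The minus sign comes from the loss \<open>- y * u + \<psi> u\<close>, in which adding \<open>z\<close> to the reward adds the
    linear term \<open>- z * u\<close>; the symmetry of the normal law absorbs it.\<close>
  define Z where "Z t \<omega> = (\<lambda>i\<in>{..<t}. - sqrt (c t i \<omega>) * \<xi>' t \<omega> i)" for t \<omega>
  have sqrt_c: "sqrt (c t i \<omega>) = a * sqrt (fisher Q (X i \<omega> \<bullet> est (?H t \<omega>)))" for t i \<omega>
    using \<open>a > 0\<close> by (simp add: c_def real_sqrt_mult)
  have sqrt_lam: "a * sqrt lam = sqrt (a\<^sup>2 * lam)"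
    using \<open>a > 0\<close> by (simp add: real_sqrt_mult)
  have est_F: "(\<lambda>\<omega>. est (?H t \<omega>)) \<in> borel_measurable (F t)" for t
    using assms(4) by (simp add: evill_run_def)
  \<comment> \<open>Past arms and the estimate are known at the start of the round; their inner
    product may fall anywhere on the line, and \<open>fisher\<close> is Borel on all of it.\<close>
  have c_F: "c t i \<in> borel_measurable (F t)" if "i < t" for t i
    unfolding c_def using interaction_past_arm_measurable[OF inter that] est_F
    by (intro borel_measurable_times measurable_compose[OF _ fisher_meas] borel_measurable_inner) auto
  have \<xi>_G: "\<xi> t \<in> borel_measurable (G t)"
    and \<xi>'_G: "\<xi>' t \<in> measurable (G t) (\<Pi>\<^sub>M i\<in>{..<t}. borel)"
    and \<theta>_G: "\<theta> t \<in> borel_measurable (G t)"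
    and law: "cond_law M (F t) (borel \<Otimes>\<^sub>M (\<Pi>\<^sub>M i\<in>{..<t}. borel)) (\<lambda>\<omega>. (\<xi> t \<omega>, \<xi>' t \<omega>))
            (\<lambda>\<omega>. normal_iso 1 \<Otimes>\<^sub>M normal_diag t (\<lambda>i. 1))" for t
    using assms(4) by (auto simp: evill_run_def)
  have argmin: "AE \<omega> in M. is_arg_min
      (\<lambda>\<eta>. loss Q lam (?H t \<omega>) \<eta> +
           ereal (evill_perturbation Q lam a (?H t \<omega>) (est (?H t \<omega>)) (\<xi> t \<omega>) (\<xi>' t \<omega>) \<bullet> \<eta>))
      (\<lambda>\<eta>. \<eta> \<in> \<Theta>') (\<theta> t \<omega>)" for t
    using assms(4) by (simp add: evill_run_def)
  have V_G: "(\<lambda>\<omega>. (a * sqrt lam) *\<^sub>R \<xi> t \<omega>) \<in> borel_measurable (G t)" for t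
    using \<xi>_G by (intro borel_measurable_scaleR) auto
  have Z_G: "Z t \<in> measurable (G t) (\<Pi>\<^sub>M i\<in>{..<t}. borel)" for t
    unfolding Z_def
  proof (rule measurable_restrict)
    fix i assume i: "i \<in> {..<t}"
    have "c t i \<in> borel_measurable (G t)"
      using c_F i by (intro measurable_from_subalg[OF subGF]) auto
    moreover have "(\<lambda>\<omega>. \<xi>' t \<omega> i) \<in> borel_measurable (G t)"
      using measurable_compose[OF \<xi>'_G measurable_component_singleton[OF i]] .
    ultimately show "(\<lambda>\<omega>. - sqrt (c t i \<omega>) * \<xi>' t \<omega> i) \<in> borel_measurable (G t)" by measurable
  qed
  have Z_law: "cond_law M (F t) (borel \<Otimes>\<^sub>M (\<Pi>\<^sub>M i\<in>{..<t}. borel))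
      (\<lambda>\<omega>. ((a * sqrt lam) *\<^sub>R \<xi> t \<omega>, Z t \<omega>))
      (\<lambda>\<omega>. normal_iso (a\<^sup>2 * lam) \<Otimes>\<^sub>M normal_diag t (\<lambda>i. c t i \<omega>))" for t
  proof -
    let ?P = "normal_iso 1 \<Otimes>\<^sub>M normal_diag t (\<lambda>i. 1) :: ((real ^ 'd) \<times> (nat \<Rightarrow> real)) measure"
    let ?N = "borel \<Otimes>\<^sub>M (\<Pi>\<^sub>M i\<in>{..<t}. borel) :: ((real ^ 'd) \<times> (nat \<Rightarrow> real)) measure"
    \<comment> \<open>The past enters through the scales \<open>c t i \<omega>\<close> and the fresh
      noise through \<open>x\<close> and \<open>z\<close>, the form required by
      \<open>cond_law_freeze\<close>.\<close>
    let ?h = "\<lambda>(\<omega>, x, z). (sqrt (a\<^sup>2 * lam) *\<^sub>R x, \<lambda>i\<in>{..<t}. - sqrt (c t i \<omega>) * z i)"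
    interpret pair_prob_space "normal_iso 1 :: (real ^ 'd) measure" "normal_diag t (\<lambda>i. 1)"
      by (intro pair_prob_space.intro pair_sigma_finite.intro prob_space_imp_sigma_finite
        prob_space_normal_iso prob_space_normal_diag)
    have sets_P: "sets ?P = sets ?N"
      by (rule sets_pair_measure_cong) (simp_all add: sets_normal_diag)
    have "?h \<in> measurable (F t \<Otimes>\<^sub>M ?N) ?N"
      unfolding case_prod_beta
    proof (intro measurable_Pair measurable_restrict)
      fix i assume i: "i \<in> {..<t}"
      have "(\<lambda>p. c t i (fst p)) \<in> borel_measurable (F t \<Otimes>\<^sub>M ?N)"
        using c_F i by (intro measurable_compose[OF measurable_fst]) auto
      moreover have "(\<lambda>p. snd (snd p) i) \<in> borel_measurable (F t \<Otimes>\<^sub>M ?N)"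
        using i by (intro measurable_compose[OF measurable_snd measurable_compose[OF measurable_snd
          measurable_component_singleton]])
      ultimately show "(\<lambda>p. - sqrt (c t i (fst p)) * snd (snd p) i) \<in> borel_measurable (F t \<Otimes>\<^sub>M ?N)"
        by measurable
    qed measurable
    from cond_law_freeze[OF M subF law prob_space_axioms sets_P this]
    have "cond_law M (F t) ?N (\<lambda>\<omega>. ?h (\<omega>, \<xi> t \<omega>, \<xi>' t \<omega>)) (\<lambda>\<omega>. distr ?P ?N (\<lambda>v. ?h (\<omega>, v)))"
      by (simp only: split_conv)
    moreover have "distr ?P ?N (\<lambda>v. ?h (\<omega>, v)) =
        normal_iso (a\<^sup>2 * lam) \<Otimes>\<^sub>M normal_diag t (\<lambda>i. c t i \<omega>)" for \<omega>
      by (rule trans[OF _ distr_normal_iso_diag]) (intro distr_cong refl, auto)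
    ultimately show ?thesis
      unfolding sqrt_lam Z_def by (simp only: split_conv)
  qed
  \<comment> \<open>The law in \<open>glm_phe_run\<close> is a function of the data; on the history
    it has the variances \<open>c t i \<omega>\<close>, compared at indices below
    \<open>t\<close>.\<close>
  have kernel: "normal_diag (length (?H t \<omega>)) (\<lambda>i. a\<^sup>2 * fisher Q (fst (?H t \<omega> ! i) \<bullet> est (?H t \<omega>))) =
      normal_diag t (\<lambda>i. c t i \<omega>)" for t \<omega>
    by (auto simp: normal_diag_def c_def intro!: PiM_cong)
  have perturbation: "evill_perturbation Q lam a (?H t \<omega>) (est (?H t \<omega>)) (\<xi> t \<omega>) (\<xi>' t \<omega>) =
      (a * sqrt lam) *\<^sub>R \<xi> t \<omega> - (\<Sum>i<length (?H t \<omega>). Z t \<omega> i *\<^sub>R fst (?H t \<omega> ! i))" for t \<omega>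
    by (simp add: evill_perturbation_def Z_def sqrt_c scaleR_sum_right sum_negf mult.assoc)
  have argmin_ext: "AE \<omega> in M. is_arg_min
      (\<lambda>\<eta>. loss_ext Q lam (perturb (?H t \<omega>) (Z t \<omega>)) \<eta> + ereal (((a * sqrt lam) *\<^sub>R \<xi> t \<omega>) \<bullet> \<eta>))
      (\<lambda>\<eta>. \<eta> \<in> \<Theta>') (\<theta> t \<omega>)" for t
  proof -
    have "AE \<omega> in M. Y i \<omega> \<in> supp Q" for i
      using inter by (intro AE_reward_in_supp[OF prob_Q sets_Q M subG]) (auto simp: interaction_def)
    \<comment> \<open>Finitely many past rewards give one common null set, outside of which the two
      objectives agree at every parameter at once and so share their minimisers.\<close>
    then have "AE \<omega> in M. \<forall>i\<in>{..<t}. Y i \<omega> \<in> supp Q" by (intro AE_finite_allI) auto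
    with argmin[of t] show ?thesis
    proof eventually_elim
      case (elim \<omega>)
      have "loss_ext Q lam (perturb (?H t \<omega>) (Z t \<omega>)) \<eta> + ereal (((a * sqrt lam) *\<^sub>R \<xi> t \<omega>) \<bullet> \<eta>) =
          loss Q lam (?H t \<omega>) \<eta> +
           ereal (evill_perturbation Q lam a (?H t \<omega>) (est (?H t \<omega>)) (\<xi> t \<omega>) (\<xi>' t \<omega>) \<bullet> \<eta>)" for \<eta>
        unfolding perturbation using elim(2) by (intro loss_ext_perturb) simp
      then show ?case using elim(1) by simp
    qed
  qed
  show ?thesis
    unfolding glm_phe_run_def kernel
    by (intro exI[of _ Z] conjI allI inter opt V_G Z_G Z_law \<theta>_G argmin_ext)
qed

end
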